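(* Let $m,n\ge 1$ be integers, $\sigma>0$, $K\subset\mathbb{R}^n$ a closed convex set and $\mu_0\in K$. The following hold. (1) The fixed point equation $$n^{-1}\,\mathbb{E}\,\mathrm{err}\big(\omega_{m/n}(r)\big)=r^2$$ has at most one solution in $r\in(0,\infty)$, which exists if and only if $m>\delta_K$. (2) Suppose $m>\delta_K$ and let $r_n$ be the unique solution to the fixed point equation. Let the iterations $\{r_{n,t}:t=0,1,2,\ldots\}\subset[0,\infty)$ be defined through $$r_{n,t+1}^2= n^{-1}\,\mathbb{E}\,\mathrm{err}\big(\omega_{m/n}(r_{n,t})\big),\quad t=0,1,2,\ldots,$$ with initialization $r_{n,0}^2=0$. Then for any $\rho\in\big(r_n^2/(r_n^2+\sigma^2),1\big)$, there exists $T_\rho\in\mathbb{N}$ such that $|r_{n,t}-r_n|/r_n\le\rho^{(t-T_\rho)_+}$. In particular, $\lim_{t\to\infty}r_{n,t}=r_n$ and the convergence is linear eventually. (3) Suppose $m>\delta_K$ and let $r_n=r_n(\sigma)$ be the unique solution to the fixed point equation. Then $$\frac{\delta_K}{m-\delta_K}\le\frac{r_n^2(\sigma)}{\sigma^2}\le\frac{\delta_{T_K(\mu_0)}}{(m-\delta_{T_K(\mu_0)})_+}.$$ The upper bound is tight in the low noise limit $\sigma\downarrow0$ when $m>\delta_{T_K(\mu_0)}$.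
   Context: $\|\cdot\|$ is the Euclidean norm, $\Pi_K$ the metric projection onto $K$, $h\sim\mathcal{N}(0,I_n)$. For $\tau\ge0$, $\mathrm{err}(\tau)=\|\Pi_K(\mu_0+\tau h)-\mu_0\|^2$. For $r\ge0$, $\delta>0$, $\omega_\delta(r)=\sqrt{(r^2+\sigma^2)/\delta}$. $\delta_K=\lim_{\tau\uparrow\infty}\mathbb{E}\|\Pi_K(\tau h)\|^2/\tau^2$ (equal to $\mathbb{E}\|\Pi_K(h)\|^2$ if $K$ is a closed convex cone); the same definition applies to the closed convex cone $T_K(\mu_0)=\mathrm{cl}\{\alpha(\nu-\mu_0):\alpha\ge0,\nu\in K\}$, the tangent cone of $K$ at $\mu_0$. $a_+=\max(a,0)$. Tightness in (3) means that $r_n^2(\sigma)/\sigma^2$ converges to the upper bound $\delta_{T_K(\mu_0)}/(m-\delta_{T_K(\mu_0)})$ as $\sigma\downarrow0$ with $(n,m,\mu_0,K)$ fixed.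
   Formalization: In (1), the claim that a solution exists if and only if m > δ_K is stated only for K ≠ {μ_0}; for K = {μ_0} it is false, since err = 0 and δ_K = 0 < m but 0 = r² has no solution in (0,∞). *)

theory Defs
  imports "HOL-Probability.Probability"
begin

text \<open>The law of \<open>h \<sim> N(0, I\<^sub>n)\<close>: the vector with i.i.d. standard normal coordinates.\<close>

definition std_gaussian :: "(real ^ 'n) measure" where
  "std_gaussian =
     distr (\<Pi>\<^sub>M i\<in>(UNIV :: 'n set). density lborel (\<lambda>x. ennreal (std_normal_density x)))
       borel (\<lambda>x. \<chi> i. x i)"

lemma prob_space_std_gaussian: "prob_space (std_gaussian :: (real ^ 'n) measure)"
proof -
  let ?N = "density lborel (\<lambda>x. ennreal (std_normal_density x))"
  interpret product_prob_space "\<lambda>_ :: 'n. ?N" UNIV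
    by (rule product_prob_spaceI) (simp add: prob_space_normal_density)
  have "(\<lambda>x. \<chi> i. x i) \<in> borel_measurable (\<Pi>\<^sub>M i\<in>(UNIV :: 'n set). ?N)"
  proof (rule borel_measurable_euclidean_space[THEN iffD2], rule ballI)
    fix b :: "real ^ 'n" assume "b \<in> Basis"
    then obtain j where "b = axis j 1" by (auto simp: Basis_vec_def)
    moreover have "(\<lambda>x. x j) \<in> borel_measurable (\<Pi>\<^sub>M i\<in>(UNIV :: 'n set). ?N)"
      using measurable_component_singleton[of j UNIV "\<lambda>_. ?N"] by simp
    ultimately show "(\<lambda>x. (\<chi> i. x i) \<bullet> b) \<in> borel_measurable (\<Pi>\<^sub>M i\<in>(UNIV :: 'n set). ?N)"
      by (simp add: inner_axis)
  qed
  then show ?thesis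
    unfolding std_gaussian_def by (rule prob_space_distr)
qed

text \<open>For \<open>K\<close> closed, convex and nonempty, the metric projection \<open>\<Pi>\<^sub>K\<close> is \<^const>\<open>closest_point\<close>.\<close>

definition proj_err :: "(real ^ 'n) set \<Rightarrow> real ^ 'n \<Rightarrow> real \<Rightarrow> real ^ 'n \<Rightarrow> real" where
  "proj_err K \<mu>\<^sub>0 \<tau> h = (norm (closest_point K (\<mu>\<^sub>0 + \<tau> *\<^sub>R h) - \<mu>\<^sub>0))\<^sup>2"

definition omega :: "real \<Rightarrow> real \<Rightarrow> real \<Rightarrow> real" where
  "omega \<delta> \<sigma> r = sqrt ((r\<^sup>2 + \<sigma>\<^sup>2) / \<delta>)"

text \<open>For \<open>K\<close> closed, convex and nonempty this limit exists, so \<^const>\<open>Lim\<close> (a definite description)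
  denotes it; for a closed convex cone the quotient does not depend on \<open>\<tau>\<close>.\<close>

definition stat_dim :: "(real ^ 'n) set \<Rightarrow> real" where
  "stat_dim K =
     Lim at_top (\<lambda>\<tau>::real. (LINT h|std_gaussian. (norm (closest_point K (\<tau> *\<^sub>R h)))\<^sup>2) / \<tau>\<^sup>2)"

definition tangent_cone :: "(real ^ 'n) set \<Rightarrow> real ^ 'n \<Rightarrow> (real ^ 'n) set" where
  "tangent_cone K \<mu>\<^sub>0 = closure {\<alpha> *\<^sub>R (\<nu> - \<mu>\<^sub>0) | \<alpha> \<nu>. 0 \<le> \<alpha> \<and> \<nu> \<in> K}"

definition fp_map :: "(real ^ 'n) set \<Rightarrow> real ^ 'n \<Rightarrow> nat \<Rightarrow> real \<Rightarrow> real \<Rightarrow> real" where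
  "fp_map K \<mu>\<^sub>0 m \<sigma> r =
     (LINT h|std_gaussian. proj_err K \<mu>\<^sub>0 (omega (real m / real CARD('n)) \<sigma> r) h) / real CARD('n)"

text \<open>Solutions are sought in \<open>(0, \<infinity>)\<close>. If \<open>K = {\<mu>\<^sub>0}\<close> then \<^const>\<open>fp_map\<close> is identically zero and there
  is no solution, although then \<open>stat_dim K = 0 < m\<close>.\<close>

definition is_fp_solution :: "(real ^ 'n) set \<Rightarrow> real ^ 'n \<Rightarrow> nat \<Rightarrow> real \<Rightarrow> real \<Rightarrow> bool" where
  "is_fp_solution K \<mu>\<^sub>0 m \<sigma> r \<longleftrightarrow> 0 < r \<and> fp_map K \<mu>\<^sub>0 m \<sigma> r = r\<^sup>2"

end

theory Submission
  imports Defs "HOL-Real_Asymp.Real_Asymp"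
begin

text \<open>
  Let \<open>G(\<tau>) = E err(\<tau>)\<close>. Writing \<open>a, b\<close> for the norms of \<open>\<Pi>\<^sub>K(\<mu>\<^sub>0 + \<tau>h) - \<mu>\<^sub>0\<close> at \<open>\<tau> = s < t\<close>, the
  variational inequalities for the two projections combine to \<open>(t a - s b) (a - b) \<le> 0\<close>, so that
  \<open>G\<close> increases while \<open>G(\<tau>)/\<tau>\<^sup>2\<close> decreases, from \<open>\<delta>\<close> of the tangent cone at \<open>\<tau> = 0\<close> to \<open>\<delta>\<^sub>K\<close> at
  infinity. The fixed point equation says that \<open>G(\<tau>)/\<tau>\<^sup>2 = m r\<^sup>2/(r\<^sup>2 + \<sigma>\<^sup>2)\<close> at \<open>\<tau> = \<omega>(r)\<close>; the
  right-hand side increases strictly from \<open>0\<close> to \<open>m\<close>, which gives uniqueness, existence and the bounds.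
\<close>

section \<open>The standard Gaussian vector\<close>

lemma sets_std_gaussian [measurable_cong, simp]: "sets std_gaussian = sets borel"
  by (simp add: std_gaussian_def)

lemma space_std_gaussian [simp]: "space std_gaussian = UNIV"
  by (simp add: std_gaussian_def)

lemma measurable_vec_lambda_PiM [measurable]:
  "(\<lambda>x. \<chi> i. x i) \<in>
     (\<Pi>\<^sub>M i\<in>(UNIV :: 'n::finite set). density lborel (\<lambda>x. ennreal (std_normal_density x)))
       \<rightarrow>\<^sub>M (borel :: (real ^ 'n) measure)"
proof (rule borel_measurable_euclidean_space[THEN iffD2], rule ballI)
  let ?N = "density lborel (\<lambda>x. ennreal (std_normal_density x))"
  fix b :: "real ^ 'n" assume "b \<in> Basis"
  then obtain j where "b = axis j 1" by (auto simp: Basis_vec_def)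
  moreover have "(\<lambda>x. x j) \<in> borel_measurable (\<Pi>\<^sub>M i\<in>(UNIV :: 'n set). ?N)"
    using measurable_component_singleton[of j UNIV "\<lambda>_. ?N"] by simp
  ultimately show "(\<lambda>x. (\<chi> i. x i) \<bullet> b) \<in> borel_measurable (\<Pi>\<^sub>M i\<in>(UNIV :: 'n set). ?N)"
    by (simp add: inner_axis)
qed

lemma measurable_vec_nth_borel [measurable]: "(\<lambda>x. x $ i) \<in> borel_measurable (borel :: (real ^ 'n) measure)"
  by (intro borel_measurable_continuous_onI continuous_intros)

lemma distr_std_gaussian_component:
  "distr (std_gaussian :: (real ^ 'n) measure) borel (\<lambda>x. x $ i) =
     density lborel (\<lambda>x. ennreal (std_normal_density x))"
proof -
  let ?N = "density lborel (\<lambda>x. ennreal (std_normal_density x))"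
  have "distr (std_gaussian :: (real ^ 'n) measure) borel (\<lambda>x. x $ i) =
      distr (\<Pi>\<^sub>M i\<in>(UNIV :: 'n set). ?N) borel ((\<lambda>x. x $ i) \<circ> (\<lambda>x. \<chi> i. x i))"
    unfolding std_gaussian_def by (rule distr_distr) measurable
  also have "\<dots> = distr (\<Pi>\<^sub>M i\<in>(UNIV :: 'n set). ?N) ?N (\<lambda>x. x i)"
    by (rule distr_cong) auto
  also have "\<dots> = ?N"
    by (rule distr_PiM_component) (auto intro: prob_space_normal_density)
  finally show ?thesis .
qed

lemma integrable_std_gaussian_norm_square:
  "integrable std_gaussian (\<lambda>h :: real ^ 'n. (norm h)\<^sup>2)"
proof -
  have "integrable std_gaussian (\<lambda>h :: real ^ 'n. (h $ i)\<^sup>2)" for i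
  proof -
    have "integrable (density lborel (\<lambda>x. ennreal (std_normal_density x))) (\<lambda>x. x\<^sup>2)"
      by (subst integrable_real_density) (auto intro: integrable_std_normal_moment)
    then have "integrable (distr (std_gaussian :: (real ^ 'n) measure) borel (\<lambda>x. x $ i)) (\<lambda>x. x\<^sup>2)"
      by (simp add: distr_std_gaussian_component)
    then show ?thesis
      by (subst (asm) integrable_distr_eq) auto
  qed
  moreover have "(norm h)\<^sup>2 = (\<Sum>i\<in>UNIV. (h $ i)\<^sup>2)" for h :: "real ^ 'n"
    by (simp add: norm_vec_def L2_set_def sum_nonneg)
  ultimately show ?thesis by simp
qed

lemma integrable_std_gaussian_norm:
  "integrable std_gaussian (\<lambda>h :: real ^ 'n. norm h)"
proof -
  interpret prob_space "std_gaussian :: (real ^ 'n) measure" by (rule prob_space_std_gaussian)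
  show ?thesis
  proof (rule Bochner_Integration.integrable_bound)
    show "integrable std_gaussian (\<lambda>h :: real ^ 'n. 1 + (norm h)\<^sup>2)"
      using integrable_std_gaussian_norm_square by auto
    have "norm h \<le> 1 + (norm h)\<^sup>2" for h :: "real ^ 'n"
      using zero_le_power2[of "norm h - 1"] norm_ge_zero[of h]
      unfolding power2_eq_square left_diff_distrib right_diff_distrib by linarith
    then show "AE h in std_gaussian. norm (norm (h :: real ^ 'n)) \<le> norm (1 + (norm h)\<^sup>2)"
      by (auto intro!: AE_I2 order.trans[OF _ abs_ge_self])
  qed measurable
qed

text \<open>The vectors whose coordinates share the signs of \<open>x\<close> form a product set on
  which the inner product with \<open>x\<close> is positive. Its Gaussian measure is a product of
  positive one-dimensional measures. This is what makes the expected error strictly positive as soon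
  as \<open>K\<close> has a second point.\<close>

lemma std_gaussian_not_AE_halfspace:
  fixes x :: "real ^ 'n"
  assumes "x \<noteq> 0"
  shows "\<not> (AE h in std_gaussian. h \<bullet> x \<le> 0)"
proof
  assume AE: "AE h in std_gaussian. h \<bullet> x \<le> 0"
  let ?N = "density lborel (\<lambda>x. ennreal (std_normal_density x))"
  let ?P = "\<Pi>\<^sub>M i\<in>(UNIV :: 'n set). ?N"
  interpret product_prob_space "\<lambda>_ :: 'n. ?N" UNIV
    by (rule product_prob_spaceI) (simp add: prob_space_normal_density)
  \<comment> \<open>A coordinate where \<open>x\<close> vanishes contributes nothing to the inner
    product, so there \<open>A i\<close> is the whole line.\<close>
  define A where "A i = {u :: real. u * x $ i > 0 \<or> x $ i = 0}" for i
  have A[measurable]: "A i \<in> sets borel" for i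
    unfolding A_def by measurable
  have pos: "emeasure ?N (A i) \<noteq> 0" for i
  proof
    assume 0: "emeasure ?N (A i) = 0"
    have "A i \<in> null_sets ?N" using 0 by (auto intro: null_setsI)
    then have "AE u in lborel. u \<in> A i \<longrightarrow> ennreal (std_normal_density u) = 0"
      by (subst (asm) null_sets_density_iff) auto
    then have "AE u in lborel. u \<notin> A i"
      by (rule eventually_mono) (use normal_density_pos[of 1 0] in \<open>auto simp: order.strict_implies_not_eq[symmetric]\<close>)
    then have "A i \<in> null_sets lborel"
      by (subst AE_iff_null_sets) auto
    \<comment> \<open>An interval of length one inside \<open>A i\<close> contradicts Lebesgue
      measure zero. The second case also covers \<open>x $ i = 0\<close>.\<close>
    moreover have "\<exists>a. {a<..<a+1} \<subseteq> A i"
    proof (cases "x $ i < 0")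
      case True
      then have "{-1<..<-1+1} \<subseteq> A i" by (auto simp: A_def mult_neg_neg)
      then show ?thesis by blast
    next
      case False
      then have "{0<..<0+1} \<subseteq> A i" by (auto simp: A_def)
      then show ?thesis by blast
    qed
    then obtain a where "{a<..<a+1} \<subseteq> A i" by blast
    ultimately have "{a<..<a+1} \<in> null_sets lborel"
      by (auto intro: null_sets_subset)
    then show False by (simp add: null_sets_def)
  qed
  have "AE z in ?P. (\<chi> i. z i) \<bullet> x \<le> 0"
    using AE unfolding std_gaussian_def by (subst (asm) AE_distr_iff) auto
  moreover have "(\<chi> i. z i) \<bullet> x > 0" if "\<forall>i\<in>UNIV. z i \<in> A i" for z
  proof -
    obtain j where j: "x $ j \<noteq> 0" using assms by (auto simp: vec_eq_iff)
    have "0 < (\<Sum>i\<in>UNIV. z i * x $ i)"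
    proof (rule sum_pos2)
      show "0 < z j * x $ j" using that j by (auto simp: A_def)
      show "0 \<le> z i * x $ i" for i using that by (cases "x $ i = 0") (auto simp: A_def intro: less_imp_le)
    qed auto
    then show ?thesis by (simp add: inner_vec_def)
  qed
  ultimately have "AE z in ?P. \<not> (\<forall>i\<in>UNIV. z i \<in> A i)"
    by (elim eventually_mono) (meson not_le)
  then have "emeasure ?P {z\<in>space ?P. \<forall>i\<in>UNIV. z i \<in> A i} = 0"
    by (subst (asm) AE_iff_measurable[OF _ refl]) auto
  moreover have "emeasure ?P {z\<in>space ?P. \<forall>i\<in>UNIV. z i \<in> A i} = (\<Prod>i\<in>UNIV. emeasure ?N (A i))"
    by (rule emeasure_PiM_Collect) auto
  ultimately show False
    using pos by auto
qed

section \<open>Projections onto a pointed convex set\<close>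

text \<open>The function \<open>G\<close> above, without the factor \<open>1/n\<close>, so that
  \<open>G(\<tau>)/\<tau>\<^sup>2\<close> compares directly with \<open>stat_dim\<close>.\<close>

definition expected_err :: "(real ^ 'n) set \<Rightarrow> real ^ 'n \<Rightarrow> real \<Rightarrow> real" where
  "expected_err K \<mu> \<tau> = (LINT h|std_gaussian. proj_err K \<mu> \<tau> h)"

locale pointed_convex =
  fixes K :: "(real ^ 'n) set" and \<mu> :: "real ^ 'n"
  assumes closed: "closed K" and convex: "convex K" and base: "\<mu> \<in> K"
begin

lemma nonempty: "K \<noteq> {}"
  using base by auto

text \<open>This is the projection of \<open>\<tau> *\<^sub>R h\<close> onto
  \<open>K - \<mu>\<close>, a convex set that contains the origin.\<close>

definition shift :: "real \<Rightarrow> real ^ 'n \<Rightarrow> real ^ 'n" where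
  "shift \<tau> h = closest_point K (\<mu> + \<tau> *\<^sub>R h) - \<mu>"

lemma proj_err_eq: "proj_err K \<mu> \<tau> h = (norm (shift \<tau> h))\<^sup>2"
  by (simp add: proj_err_def shift_def)

lemma add_shift_in: "\<mu> + shift \<tau> h \<in> K"
  by (simp add: shift_def closest_point_in_set closed nonempty)

lemma shift_dot:
  assumes "\<mu> + y \<in> K"
  shows "(\<tau> *\<^sub>R h - shift \<tau> h) \<bullet> (y - shift \<tau> h) \<le> 0"
  using closest_point_dot[OF convex closed assms, of "\<mu> + \<tau> *\<^sub>R h"]
  by (simp add: shift_def algebra_simps)

text \<open>Projections are nonexpansive and \<open>\<mu>\<close> is its own projection. Squared,
  this is the integrable majorant used for integrability and for dominated convergence.\<close>

lemma norm_shift_le: "norm (shift \<tau> h) \<le> \<bar>\<tau>\<bar> * norm h"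
  using closest_point_lipschitz[OF convex closed nonempty, of "\<mu> + \<tau> *\<^sub>R h" \<mu>]
  by (simp add: shift_def dist_norm closest_point_self base)

lemma proj_err_le: "proj_err K \<mu> \<tau> h \<le> \<tau>\<^sup>2 * (norm h)\<^sup>2"
  using power_mono[OF norm_shift_le, of \<tau> h 2] by (simp add: proj_err_eq power_mult_distrib)

text \<open>The inequality \<open>key\<close> places \<open>a\<close> between
  \<open>(s / t) * b\<close> and \<open>b\<close>, and these two ends are the two
  conclusions.\<close>

lemma norm_shift_scaling:
  assumes "0 < s" "s < t"
  shows "norm (shift s h) \<le> norm (shift t h)" "s * norm (shift t h) \<le> t * norm (shift s h)"
proof -
  define p q where "p = shift s h" and "q = shift t h"
  define a b where "a = norm p" and "b = norm q"
  have ab: "0 \<le> a" "0 \<le> b" by (auto simp: a_def b_def)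
  have 1: "(s *\<^sub>R h - p) \<bullet> (q - p) \<le> 0" and 2: "(t *\<^sub>R h - q) \<bullet> (p - q) \<le> 0"
    unfolding p_def q_def by (intro shift_dot add_shift_in)+
  \<comment> \<open>The weights \<open>t\<close> and \<open>s\<close> make the terms containing
    \<open>h\<close> cancel.\<close>
  have "t * ((s *\<^sub>R h - p) \<bullet> (q - p)) + s * ((t *\<^sub>R h - q) \<bullet> (p - q)) \<le> 0"
    using mult_nonneg_nonpos[OF _ 1, of t] mult_nonneg_nonpos[OF _ 2, of s] assms by simp
  then have "t * (p \<bullet> p) + s * (q \<bullet> q) \<le> (s + t) * (p \<bullet> q)"
    by (simp add: algebra_simps inner_commute)
  also have "\<dots> \<le> (s + t) * (a * b)"
    using norm_cauchy_schwarz[of p q] assms by (intro mult_left_mono) (auto simp: a_def b_def)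
  finally have key: "(t * a - s * b) * (a - b) \<le> 0"
    by (simp add: a_def b_def dot_square_norm power2_eq_square algebra_simps)
  have "a \<le> b \<and> s * b \<le> t * a"
  proof (cases "a \<le> b")
    case True
    show ?thesis
    proof (cases "a = b")
      case True
      then show ?thesis using assms ab by (auto intro: mult_right_mono)
    next
      case False
      with True key have "0 \<le> t * a - s * b"
        by (auto simp: mult_le_0_iff)
      with True show ?thesis by simp
    qed
  next
    \<comment> \<open>Here \<open>b < a\<close>, so \<open>t * a \<le> s * b \<le> s * a\<close>
      with \<open>s < t\<close> forces \<open>a \<le> 0\<close>, which contradicts
      \<open>0 \<le> b\<close>.\<close>
    case False
    with key have "t * a \<le> s * b" by (auto simp: mult_le_0_iff)
    also have "s * b \<le> s * a" using False assms by (intro mult_left_mono) auto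
    finally have "a \<le> 0" using assms by (simp add: mult_le_cancel_right)
    with False ab show ?thesis by auto
  qed
  then show "norm (shift s h) \<le> norm (shift t h)" "s * norm (shift t h) \<le> t * norm (shift s h)"
    by (auto simp: a_def b_def p_def q_def)
qed

lemma continuous_closest_point [continuous_intros]:
  "continuous_on A f \<Longrightarrow> continuous_on A (\<lambda>x. closest_point K (f x))"
  by (rule continuous_on_compose2[OF continuous_on_closest_point[OF convex closed nonempty, of UNIV]]) auto

lemma measurable_proj_err [measurable]: "proj_err K \<mu> \<tau> \<in> borel_measurable borel"
  unfolding proj_err_def [abs_def] by (intro borel_measurable_continuous_onI continuous_intros)

lemma integrable_proj_err: "integrable std_gaussian (proj_err K \<mu> \<tau>)"
proof (rule Bochner_Integration.integrable_bound)
  show "integrable std_gaussian (\<lambda>h :: real ^ 'n. \<tau>\<^sup>2 * (norm h)\<^sup>2)"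
    using integrable_std_gaussian_norm_square by auto
  show "AE h in std_gaussian. norm (proj_err K \<mu> \<tau> h) \<le> norm (\<tau>\<^sup>2 * (norm h)\<^sup>2)"
    using proj_err_le by (auto simp: proj_err_eq)
qed measurable

lemma expected_err_nonneg: "0 \<le> expected_err K \<mu> \<tau>"
  unfolding expected_err_def by (rule integral_nonneg_AE) (simp add: proj_err_def)

lemma expected_err_mono:
  assumes "0 < s" "s \<le> t"
  shows "expected_err K \<mu> s \<le> expected_err K \<mu> t"
  unfolding expected_err_def
proof (intro integral_mono integrable_proj_err)
  show "proj_err K \<mu> s h \<le> proj_err K \<mu> t h" for h
    using norm_shift_scaling(1)[of s t h] assms
    by (cases "s = t") (auto simp: proj_err_eq intro!: power_mono)
qed

lemma expected_err_ratio_antimono: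
  assumes "0 < s" "s \<le> t"
  shows "expected_err K \<mu> t / t\<^sup>2 \<le> expected_err K \<mu> s / s\<^sup>2"
proof -
  have "proj_err K \<mu> t h / t\<^sup>2 \<le> proj_err K \<mu> s h / s\<^sup>2" for h
  proof (cases "s = t")
    case False
    then have "norm (shift t h) / t \<le> norm (shift s h) / s"
      using norm_shift_scaling(2)[of s t h] assms by (simp add: field_simps)
    then have "(norm (shift t h) / t)\<^sup>2 \<le> (norm (shift s h) / s)\<^sup>2"
      using assms by (intro power_mono) auto
    then show ?thesis by (simp add: proj_err_eq power_divide)
  qed simp
  then have "(LINT h|std_gaussian. proj_err K \<mu> t h / t\<^sup>2) \<le> (LINT h|std_gaussian. proj_err K \<mu> s h / s\<^sup>2)"
    by (intro integral_mono integrable_divide integrable_proj_err)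
  then show ?thesis by (simp add: expected_err_def)
qed

text \<open>The two monotonicity properties alone suffice: they trap \<open>E u\<close> between
  \<open>E t\<close> times the minimum and \<open>E t\<close> times the maximum of \<open>1\<close>
  and \<open>(u / t)\<^sup>2\<close>, and both bounds tend to \<open>E t\<close>.\<close>

lemma isCont_expected_err:
  assumes "0 < t"
  shows "isCont (expected_err K \<mu>) t"
proof -
  define E where "E = expected_err K \<mu>"
  have *: "E u \<le> max 1 ((u / t)\<^sup>2) * E t" "min 1 ((u / t)\<^sup>2) * E t \<le> E u" if "0 < u" for u
  proof -
    have Et: "0 \<le> E t" by (simp add: E_def expected_err_nonneg)
    show "E u \<le> max 1 ((u / t)\<^sup>2) * E t"
    proof (cases "u \<le> t")
      case True
      then have "E u \<le> 1 * E t" using that expected_err_mono by (simp add: E_def)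
      also have "\<dots> \<le> max 1 ((u / t)\<^sup>2) * E t" using Et by (intro mult_right_mono) auto
      finally show ?thesis .
    next
      case False
      then have "E u \<le> (u / t)\<^sup>2 * E t"
        using expected_err_ratio_antimono[of t u] assms that by (simp add: E_def field_simps)
      also have "\<dots> \<le> max 1 ((u / t)\<^sup>2) * E t" using Et by (intro mult_right_mono) auto
      finally show ?thesis .
    qed
    show "min 1 ((u / t)\<^sup>2) * E t \<le> E u"
    proof (cases "t \<le> u")
      case True
      have "min 1 ((u / t)\<^sup>2) * E t \<le> 1 * E t" using Et by (intro mult_right_mono) auto
      also have "\<dots> \<le> E u" using True assms expected_err_mono by (simp add: E_def)
      finally show ?thesis .
    next
      case False
      have "min 1 ((u / t)\<^sup>2) * E t \<le> (u / t)\<^sup>2 * E t" using Et by (intro mult_right_mono) auto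
      also have "\<dots> \<le> E u"
        using expected_err_ratio_antimono[of u t] assms that False by (simp add: E_def field_simps)
      finally show ?thesis .
    qed
  qed
  have ev: "\<forall>\<^sub>F u in at t. 0 < u"
    using assms by (intro order_tendstoD(1)[OF tendsto_ident_at])
  have "((\<lambda>u. max 1 ((u / t)\<^sup>2) * E t) \<longlongrightarrow> max 1 ((t / t)\<^sup>2) * E t) (at t)"
    using assms by (intro tendsto_intros) auto
  moreover have "((\<lambda>u. min 1 ((u / t)\<^sup>2) * E t) \<longlongrightarrow> min 1 ((t / t)\<^sup>2) * E t) (at t)"
    using assms by (intro tendsto_intros) auto
  ultimately have "(E \<longlongrightarrow> E t) (at t)"
    using assms by (intro tendsto_sandwich[of "\<lambda>u. min 1 ((u / t)\<^sup>2) * E t" E _ "\<lambda>u. max 1 ((u / t)\<^sup>2) * E t"])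
      (auto intro: eventually_mono[OF ev] *)
  then show ?thesis by (simp add: isCont_def E_def)
qed

text \<open>If the expectation vanished, almost every shift would be zero. The variational
  inequality at zero would then confine almost every \<open>h\<close> to one halfspace.\<close>

lemma expected_err_pos:
  assumes "K \<noteq> {\<mu>}" "0 < \<tau>"
  shows "0 < expected_err K \<mu> \<tau>"
proof -
  obtain \<nu> where \<nu>: "\<nu> \<in> K" "\<nu> \<noteq> \<mu>" using assms base by auto
  have "expected_err K \<mu> \<tau> \<noteq> 0"
  proof
    assume "expected_err K \<mu> \<tau> = 0"
    then have "AE h in std_gaussian. proj_err K \<mu> \<tau> h = 0"
      unfolding expected_err_def
      by (subst (asm) integral_nonneg_eq_0_iff_AE) (auto simp: integrable_proj_err proj_err_def)
    then have "AE h in std_gaussian. h \<bullet> (\<nu> - \<mu>) \<le> 0"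
    proof (rule eventually_mono)
      fix h assume "proj_err K \<mu> \<tau> h = 0"
      then have "shift \<tau> h = 0" by (simp add: proj_err_eq)
      then show "h \<bullet> (\<nu> - \<mu>) \<le> 0"
        using shift_dot[of "\<nu> - \<mu>" \<tau> h] \<nu> assms by (simp add: mult_le_0_iff)
    qed
    then show False using std_gaussian_not_AE_halfspace[of "\<nu> - \<mu>"] \<nu> by auto
  qed
  then show ?thesis using expected_err_nonneg[of \<tau>] by linarith
qed

text \<open>Moving the centre of projection from \<open>\<mu>\<close> to the origin, as the definition of the
  statistical dimension does, changes the projection by at most a constant.\<close>

lemma expected_err_ratio_tendsto_stat_dim:
  "((\<lambda>\<tau>. expected_err K \<mu> \<tau> / \<tau>\<^sup>2) \<longlongrightarrow> stat_dim K) at_top"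
proof -
  define g where "g \<tau> = expected_err K \<mu> \<tau> / \<tau>\<^sup>2" for \<tau>
  define f where "f \<tau> = (LINT h|std_gaussian. (norm (closest_point K (\<tau> *\<^sub>R h)))\<^sup>2) / \<tau>\<^sup>2" for \<tau>
  \<comment> \<open>A decreasing function bounded below converges to its infimum.\<close>
  define l where "l = Inf (g ` {0<..})"
  have bdd: "bdd_below (g ` {0<..})"
    by (rule bdd_belowI[of _ 0]) (auto simp: g_def expected_err_nonneg)
  have g: "(g \<longlongrightarrow> l) at_top"
  proof (rule order_tendstoI)
    fix a assume "a < l"
    then show "\<forall>\<^sub>F \<tau> in at_top. a < g \<tau>"
      using bdd by (intro eventually_mono[OF eventually_gt_at_top[of 0]])
        (auto simp: l_def intro: less_le_trans cINF_lower)
  next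
    fix a assume "l < a"
    then obtain s where "0 < s" "g s < a"
      using bdd by (auto simp: l_def cInf_less_iff)
    then show "\<forall>\<^sub>F \<tau> in at_top. g \<tau> < a"
      using expected_err_ratio_antimono
      by (intro eventually_mono[OF eventually_ge_at_top[of s]])
        (auto simp: g_def intro: le_less_trans)
  qed
  \<comment> \<open>One \<open>norm \<mu>\<close> bounds the effect of moving the argument of the
    projection, the other comes from subtracting \<open>\<mu>\<close> in
    \<open>shift\<close>.\<close>
  define C where "C = 2 * norm \<mu>"
  define D where "D = (LINT h|(std_gaussian :: (real ^ 'n) measure). norm h)"
  interpret prob_space "std_gaussian :: (real ^ 'n) measure" by (rule prob_space_std_gaussian)
  have C0: "0 \<le> C" by (simp add: C_def)
  \<comment> \<open>Before division by \<open>\<tau>\<^sup>2\<close> the two expectations differ by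
    a quantity growing at most linearly in \<open>\<tau>\<close>, so the quotients have the same
    limit.\<close>
  have "\<bar>f \<tau> - g \<tau>\<bar> \<le> C\<^sup>2 / \<tau>\<^sup>2 + 2 * C * D / \<tau>" if \<tau>: "0 < \<tau>" for \<tau>
  proof -
    define d where "d h = (norm (closest_point K (\<tau> *\<^sub>R h)))\<^sup>2 - proj_err K \<mu> \<tau> h" for h
    have d: "\<bar>d h\<bar> \<le> C\<^sup>2 + 2 * C * \<tau> * norm h" for h
    proof -
      define a b where "a = closest_point K (\<tau> *\<^sub>R h)" and "b = shift \<tau> h"
      have "norm (a - (b + \<mu>)) \<le> norm \<mu>"
        using closest_point_lipschitz[OF convex closed nonempty, of "\<tau> *\<^sub>R h" "\<mu> + \<tau> *\<^sub>R h"]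
        by (simp add: a_def b_def shift_def dist_norm)
      then have "norm (a - b) \<le> C"
        using norm_triangle_ineq[of "a - (b + \<mu>)" \<mu>] by (simp add: C_def)
      then have n: "\<bar>norm a - norm b\<bar> \<le> C"
        using norm_triangle_ineq3[of a b] by linarith
      have "\<bar>d h\<bar> = \<bar>norm a - norm b\<bar> * (norm a + norm b)"
        by (simp add: d_def a_def b_def proj_err_eq square_diff_square_factored abs_mult power2_eq_square)
      \<comment> \<open>By \<open>n\<close>, \<open>norm a \<le> norm b + C\<close>.\<close>
      also have "\<dots> \<le> C * (C + 2 * norm b)"
        using n C0 by (intro mult_mono) auto
      also have "\<dots> \<le> C * (C + 2 * (\<tau> * norm h))"
        using norm_shift_le[of \<tau> h] C0 \<tau> by (intro mult_left_mono) (auto simp: b_def)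
      finally show ?thesis by (simp add: power2_eq_square algebra_simps)
    qed
    have int: "integrable std_gaussian (\<lambda>h :: real ^ 'n. C\<^sup>2 + 2 * C * \<tau> * norm h)"
      using integrable_std_gaussian_norm by auto
    have [measurable]: "(\<lambda>h. (norm (closest_point K (\<tau> *\<^sub>R h)))\<^sup>2) \<in> borel_measurable borel"
      by (intro borel_measurable_continuous_onI continuous_intros)
    have intd: "integrable std_gaussian d"
      by (rule Bochner_Integration.integrable_bound[OF int])
         (use d in \<open>auto simp: d_def[abs_def] intro!: AE_I2 intro: order.trans[OF _ abs_ge_self]\<close>)
    have "integrable std_gaussian (\<lambda>h. d h + proj_err K \<mu> \<tau> h)"
      using intd integrable_proj_err by (rule Bochner_Integration.integrable_add)
    then have "integrable std_gaussian (\<lambda>h. (norm (closest_point K (\<tau> *\<^sub>R h)))\<^sup>2)"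
      by (simp add: d_def)
    then have "f \<tau> - g \<tau> = (LINT h|std_gaussian. d h) / \<tau>\<^sup>2"
      using integrable_proj_err by (simp add: f_def g_def d_def expected_err_def diff_divide_distrib)
    moreover have "\<bar>LINT h|std_gaussian. d h\<bar> \<le> (LINT h|std_gaussian. C\<^sup>2 + 2 * C * \<tau> * norm (h :: real ^ 'n))"
    proof -
      have "\<bar>LINT h|std_gaussian. d h\<bar> \<le> (LINT h|std_gaussian. \<bar>d h\<bar>)"
        by (rule integral_abs_bound)
      also have "\<dots> \<le> (LINT h|std_gaussian. C\<^sup>2 + 2 * C * \<tau> * norm (h :: real ^ 'n))"
        using intd int d by (intro integral_mono) auto
      finally show ?thesis .
    qed
    moreover have "(LINT h|std_gaussian. C\<^sup>2 + 2 * C * \<tau> * norm (h :: real ^ 'n)) = C\<^sup>2 + 2 * C * \<tau> * D"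
    proof -
      have "(LINT h|std_gaussian. C\<^sup>2 + 2 * C * \<tau> * norm (h :: real ^ 'n)) =
          (LINT h|(std_gaussian :: (real ^ 'n) measure). C\<^sup>2) + (LINT h|std_gaussian. 2 * C * \<tau> * norm (h :: real ^ 'n))"
        by (rule Bochner_Integration.integral_add) (auto intro!: integrable_mult_right integrable_std_gaussian_norm)
      then show ?thesis using prob_space by (simp add: D_def)
    qed
    ultimately have "\<bar>f \<tau> - g \<tau>\<bar> \<le> (C\<^sup>2 + 2 * C * \<tau> * D) / \<tau>\<^sup>2"
      by (simp add: abs_divide divide_right_mono)
    also have "\<dots> = C\<^sup>2 / \<tau>\<^sup>2 + 2 * C * D / \<tau>"
      using \<tau> by (simp add: field_simps power2_eq_square)
    finally show ?thesis .
  qed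
  then have ev: "\<forall>\<^sub>F \<tau> in at_top. norm (f \<tau> - g \<tau>) \<le> C\<^sup>2 / \<tau>\<^sup>2 + 2 * C * D / \<tau>"
    by (intro eventually_mono[OF eventually_gt_at_top[of 0]]) auto
  have "((\<lambda>\<tau>. C\<^sup>2 / \<tau>\<^sup>2 + 2 * C * D / \<tau>) \<longlongrightarrow> 0) at_top"
    by real_asymp
  with ev have "((\<lambda>\<tau>. f \<tau> - g \<tau>) \<longlongrightarrow> 0) at_top"
    by (rule Lim_null_comparison)
  from tendsto_add[OF this g] have "(f \<longlongrightarrow> l) at_top" by simp
  then have "stat_dim K = l"
    unfolding stat_dim_def f_def [abs_def] by (intro tendsto_Lim) auto
  with g show ?thesis by (simp add: g_def [abs_def])
qed

lemma stat_dim_le_ratio: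
  assumes "0 < \<tau>"
  shows "stat_dim K \<le> expected_err K \<mu> \<tau> / \<tau>\<^sup>2"
  using expected_err_ratio_tendsto_stat_dim
  by (rule tendsto_upperbound)
     (auto intro!: eventually_mono[OF eventually_ge_at_top[of \<tau>]] expected_err_ratio_antimono assms)

section \<open>The tangent cone and the limit as \<tau> tends to 0\<close>

lemma tangent_cone_eq: "tangent_cone K \<mu> = closure (cone hull ((\<lambda>\<nu>. \<nu> - \<mu>) ` K))"
  unfolding tangent_cone_def cone_hull_expl by (rule arg_cong[of _ _ closure]) auto

lemma cone_tangent_cone: "cone (tangent_cone K \<mu>)"
  unfolding tangent_cone_eq by (intro cone_closure cone_cone_hull)

lemma pointed_tangent_cone: "pointed_convex (tangent_cone K \<mu>) 0"
proof
  show "closed (tangent_cone K \<mu>)" by (simp add: tangent_cone_def)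
  show "convex (tangent_cone K \<mu>)"
    unfolding tangent_cone_eq by (intro convex_closure convex_cone_hull convex_translation_subtract convex)
  show "0 \<in> tangent_cone K \<mu>"
    unfolding tangent_cone_def using base by (intro subsetD[OF closure_subset]) force
qed

lemma shift_scaled_in_tangent_cone:
  assumes "0 < \<tau>"
  shows "(1 / \<tau>) *\<^sub>R shift \<tau> h \<in> tangent_cone K \<mu>"
  unfolding tangent_cone_def
  using assms add_shift_in[of \<tau> h]
  by (intro subsetD[OF closure_subset] CollectI exI[of _ "1 / \<tau>"] exI[of _ "\<mu> + shift \<tau> h"]) auto

text \<open>The rescaled shift is the projection of \<open>h\<close> onto
  \<open>(K - \<mu>) / \<tau>\<close>. These sets grow as \<tau> decreases, and the closure of their
  union is the tangent cone. A point \<open>y\<close> of the union close to \<open>q\<close>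
  eventually lies in them and can be used as a test point.\<close>

lemma shift_tendsto_tangent:
  "((\<lambda>\<tau>. (1 / \<tau>) *\<^sub>R shift \<tau> h) \<longlongrightarrow> closest_point (tangent_cone K \<mu>) h) (at_right 0)"
proof -
  interpret T: pointed_convex "tangent_cone K \<mu>" 0 by (rule pointed_tangent_cone)
  define q where "q = closest_point (tangent_cone K \<mu>) h"
  define p where "p \<tau> = (1 / \<tau>) *\<^sub>R shift \<tau> h" for \<tau>
  have dot: "(h - p \<tau>) \<bullet> (y - p \<tau>) \<le> 0" if "0 < \<tau>" "\<mu> + \<tau> *\<^sub>R y \<in> K" for \<tau> y
  proof -
    have "shift \<tau> h = \<tau> *\<^sub>R p \<tau>" using that by (simp add: p_def)
    then have "\<tau> * (\<tau> * ((h - p \<tau>) \<bullet> (y - p \<tau>))) \<le> 0"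
      using shift_dot[OF that(2), of \<tau> h]
      by (simp flip: scaleR_diff_right)
    then show ?thesis using that by (simp add: mult_le_0_iff)
  qed
  have lim: "\<forall>\<^sub>F \<tau> in at_right 0. (norm (p \<tau> - q))\<^sup>2 \<le> e * norm h" if "0 < e" for e
  proof -
    have "q \<in> tangent_cone K \<mu>"
      by (simp add: q_def closest_point_in_set T.closed T.nonempty)
    then obtain c \<nu> where y: "0 \<le> c" "\<nu> \<in> K" "dist (c *\<^sub>R (\<nu> - \<mu>)) q < e"
      unfolding tangent_cone_def closure_approachable using \<open>0 < e\<close> by blast
    define y where "y = c *\<^sub>R (\<nu> - \<mu>)"
    \<comment> \<open>The condition \<open>\<tau> * c < 1\<close> makes
      \<open>\<mu> + \<tau> *\<^sub>R y\<close> a convex combination of \<open>\<mu>\<close> and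
      \<open>\<nu>\<close>.\<close>
    have "(norm (p \<tau> - q))\<^sup>2 \<le> e * norm h" if \<tau>: "0 < \<tau>" "\<tau> * c < 1" for \<tau>
    proof -
      have "(1 - \<tau> * c) *\<^sub>R \<mu> + (\<tau> * c) *\<^sub>R \<nu> \<in> K"
        using \<tau> y base by (intro convexD[OF convex]) auto
      then have "\<mu> + \<tau> *\<^sub>R y \<in> K"
        by (simp add: y_def algebra_simps)
      from dot[OF \<tau>(1) this] have 1: "(h - p \<tau>) \<bullet> (y - p \<tau>) \<le> 0" .
      have 2: "(h - q) \<bullet> (p \<tau> - q) \<le> 0"
        using closest_point_dot[OF T.convex T.closed shift_scaled_in_tangent_cone[OF \<tau>(1)]]
        by (simp add: q_def p_def)
      \<comment> \<open>The test point 0 bounds \<open>norm (h - p \<tau>)\<close> uniformly in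
        \<tau>.\<close>
      have 3: "(h - p \<tau>) \<bullet> (0 - p \<tau>) \<le> 0"
        using dot[OF \<tau>(1), of 0] base by simp
      have "(norm (h - p \<tau>))\<^sup>2 \<le> (h - p \<tau>) \<bullet> h"
        using 3 by (simp add: power2_norm_eq_inner inner_diff_right)
      also have "\<dots> \<le> norm (h - p \<tau>) * norm h" by (rule norm_cauchy_schwarz)
      finally have 4: "norm (h - p \<tau>) \<le> norm h"
        by (cases "h = p \<tau>") (auto simp: power2_eq_square)
      \<comment> \<open>Expand the square as \<open>(h - q) \<bullet> (p \<tau> - q) + (h - p
        \<tau>) \<bullet> (q - p \<tau>)\<close>. The first term is nonpositive by \<open>2\<close>;
        in the second, \<open>1\<close> allows \<open>p \<tau>\<close> to be replaced by
        \<open>y\<close>.\<close>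
      have "(norm (p \<tau> - q))\<^sup>2 \<le> (h - p \<tau>) \<bullet> (q - y)"
        using 1 2 by (simp add: power2_norm_eq_inner inner_diff_right inner_diff_left inner_commute)
      also have "\<dots> \<le> norm (h - p \<tau>) * norm (q - y)" by (rule norm_cauchy_schwarz)
      also have "\<dots> \<le> norm h * e"
        using 4 y by (intro mult_mono) (auto simp: y_def dist_norm norm_minus_commute)
      finally show ?thesis by (simp add: mult.commute)
    qed
    moreover have "((\<lambda>\<tau>. \<tau> * c) \<longlongrightarrow> 0 * c) (at_right 0)"
      by (intro tendsto_intros)
    then have "\<forall>\<^sub>F \<tau> in at_right 0. \<tau> * c < 1"
      by (intro order_tendstoD(2)) auto
    moreover have "\<forall>\<^sub>F \<tau>::real in at_right 0. 0 < \<tau>"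
      by (rule eventually_at_right_less)
    ultimately show ?thesis
      by (auto elim: eventually_elim2)
  qed
  show ?thesis
  proof (rule tendstoI)
    fix r :: real assume "0 < r"
    \<comment> \<open>Adding 1 keeps the denominator positive when \<open>h = 0\<close>, and the
      factor 2 makes the final bound strict.\<close>
    define e where "e = r\<^sup>2 / (2 * (norm h + 1))"
    have e: "0 < e" using \<open>0 < r\<close> by (auto simp: e_def add_nonneg_pos)
    have "e * norm h \<le> e * (norm h + 1)" using e by simp
    also have "\<dots> = r\<^sup>2 / 2" using norm_ge_zero[of h] by (simp add: e_def add_nonneg_eq_0_iff field_simps)
    also have "\<dots> < r\<^sup>2" using \<open>0 < r\<close> by simp
    finally have "e * norm h < r\<^sup>2" .
    with lim[OF e] have "\<forall>\<^sub>F \<tau> in at_right 0. (norm (p \<tau> - q))\<^sup>2 < r\<^sup>2"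
      by (auto elim!: eventually_mono)
    then show "\<forall>\<^sub>F \<tau> in at_right 0. dist ((1 / \<tau>) *\<^sub>R shift \<tau> h) (closest_point (tangent_cone K \<mu>) h) < r"
      by (rule eventually_mono) (use \<open>0 < r\<close> in \<open>auto simp: dist_norm p_def q_def intro: power_less_imp_less_base\<close>)
  qed
qed

text \<open>Multiplication by \<open>c\<close> maps the cone onto itself and multiplies all
  distances by \<open>c\<close>, so it carries closest points to closest points.\<close>

lemma closest_point_tangent_cone_scaleR:
  assumes "0 < c"
  shows "closest_point (tangent_cone K \<mu>) (c *\<^sub>R h) = c *\<^sub>R closest_point (tangent_cone K \<mu>) h"
proof -
  interpret T: pointed_convex "tangent_cone K \<mu>" 0 by (rule pointed_tangent_cone)
  let ?T = "tangent_cone K \<mu>"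
  have "c *\<^sub>R closest_point ?T h = closest_point ?T (c *\<^sub>R h)"
  proof (rule closest_point_unique[OF T.convex T.closed])
    show "c *\<^sub>R closest_point ?T h \<in> ?T"
      using assms T.closed T.nonempty by (intro mem_cone[OF cone_tangent_cone] closest_point_in_set) auto
    show "\<forall>z\<in>?T. dist (c *\<^sub>R h) (c *\<^sub>R closest_point ?T h) \<le> dist (c *\<^sub>R h) z"
    proof
      fix z assume "z \<in> ?T"
      then have "(1 / c) *\<^sub>R z \<in> ?T" using assms by (intro mem_cone[OF cone_tangent_cone]) auto
      from closest_point_le[OF T.closed this]
      have "norm (c *\<^sub>R (h - closest_point ?T h)) \<le> norm (c *\<^sub>R (h - (1 / c) *\<^sub>R z))"
        using assms by (simp add: dist_norm)
      then show "dist (c *\<^sub>R h) (c *\<^sub>R closest_point ?T h) \<le> dist (c *\<^sub>R h) z"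
        using assms by (simp add: dist_norm scaleR_diff_right)
    qed
  qed
  then show ?thesis by simp
qed

text \<open>For a cone the quotient under the limit is constant for positive \<tau>. The resulting
  expectation is the limit that dominated convergence produces at \<tau> = 0.\<close>

lemma stat_dim_tangent_cone:
  "stat_dim (tangent_cone K \<mu>) = (LINT h|std_gaussian. (norm (closest_point (tangent_cone K \<mu>) h))\<^sup>2)"
  unfolding stat_dim_def
proof (rule tendsto_Lim)
  show "((\<lambda>\<tau>. (LINT h|std_gaussian. (norm (closest_point (tangent_cone K \<mu>) (\<tau> *\<^sub>R h)))\<^sup>2) / \<tau>\<^sup>2) \<longlongrightarrow>
      (LINT h|std_gaussian. (norm (closest_point (tangent_cone K \<mu>) h))\<^sup>2)) at_top"
    by (rule tendsto_eventually, rule eventually_mono[OF eventually_gt_at_top[of 0]])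
       (simp add: closest_point_tangent_cone_scaleR power_mult_distrib)
qed simp

text \<open>The pointwise limit is \<open>shift_tendsto_tangent\<close> and the majorant is
  \<open>(norm h)\<^sup>2\<close>. The substitution of \<open>inverse t\<close> for \<tau> turns the
  limit at 0 into one at infinity, as the dominated convergence rule requires.\<close>

lemma expected_err_ratio_tendsto_tangent:
  "((\<lambda>\<tau>. expected_err K \<mu> \<tau> / \<tau>\<^sup>2) \<longlongrightarrow> stat_dim (tangent_cone K \<mu>)) (at_right 0)"
proof -
  interpret T: pointed_convex "tangent_cone K \<mu>" 0 by (rule pointed_tangent_cone)
  have ratio: "expected_err K \<mu> \<tau> / \<tau>\<^sup>2 = (LINT h|std_gaussian. proj_err K \<mu> \<tau> h / \<tau>\<^sup>2)" for \<tau>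
    by (simp add: expected_err_def)
  show ?thesis
    unfolding filterlim_at_right_to_top stat_dim_tangent_cone ratio
  proof (rule integral_dominated_convergence_at_top)
    show "integrable std_gaussian (\<lambda>h :: real ^ 'n. (norm h)\<^sup>2)"
      by (rule integrable_std_gaussian_norm_square)
    show "(\<lambda>h. (norm (closest_point (tangent_cone K \<mu>) h))\<^sup>2) \<in> borel_measurable std_gaussian"
      unfolding measurable_cong_sets[OF sets_std_gaussian refl]
      by (intro borel_measurable_continuous_onI continuous_intros T.continuous_closest_point)
    show "(\<lambda>h. proj_err K \<mu> (inverse t) h / (inverse t)\<^sup>2) \<in> borel_measurable std_gaussian" for t
      by measurable
    show "\<forall>\<^sub>F t in at_top. AE h in std_gaussian. norm (proj_err K \<mu> (inverse t) h / (inverse t)\<^sup>2) \<le> (norm h)\<^sup>2"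
    proof (rule eventually_mono[OF eventually_gt_at_top[of 0]], rule AE_I2)
      fix t :: real and h assume "0 < t"
      then show "norm (proj_err K \<mu> (inverse t) h / (inverse t)\<^sup>2) \<le> (norm h)\<^sup>2"
        using proj_err_le[of "inverse t" h] by (simp add: proj_err_def field_simps)
    qed
    show "AE h in std_gaussian. ((\<lambda>t. proj_err K \<mu> (inverse t) h / (inverse t)\<^sup>2) \<longlongrightarrow>
        (norm (closest_point (tangent_cone K \<mu>) h))\<^sup>2) at_top"
    proof (rule AE_I2)
      fix h
      have "((\<lambda>\<tau>. (norm ((1 / \<tau>) *\<^sub>R shift \<tau> h))\<^sup>2) \<longlongrightarrow>
          (norm (closest_point (tangent_cone K \<mu>) h))\<^sup>2) (at_right 0)"
        by (intro tendsto_intros shift_tendsto_tangent)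
      also have "(\<lambda>\<tau>. (norm ((1 / \<tau>) *\<^sub>R shift \<tau> h))\<^sup>2) = (\<lambda>\<tau>. proj_err K \<mu> \<tau> h / \<tau>\<^sup>2)"
        by (simp add: proj_err_eq power_divide fun_eq_iff)
      finally show "((\<lambda>t. proj_err K \<mu> (inverse t) h / (inverse t)\<^sup>2) \<longlongrightarrow>
        (norm (closest_point (tangent_cone K \<mu>) h))\<^sup>2) at_top"
        unfolding filterlim_at_right_to_top .
    qed
  qed
qed

lemma ratio_le_stat_dim_tangent_cone:
  assumes "0 < \<tau>"
  shows "expected_err K \<mu> \<tau> / \<tau>\<^sup>2 \<le> stat_dim (tangent_cone K \<mu>)"
  using expected_err_ratio_tendsto_tangent
proof (rule tendsto_lowerbound)
  show "\<forall>\<^sub>F s in at_right 0. expected_err K \<mu> \<tau> / \<tau>\<^sup>2 \<le> expected_err K \<mu> s / s\<^sup>2"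
    unfolding eventually_at_right_field
    using assms expected_err_ratio_antimono by (intro exI[of _ \<tau>]) auto
qed simp

end

section \<open>The fixed point equation\<close>

lemma omega_pos: "0 < \<delta> \<Longrightarrow> 0 < \<sigma> \<Longrightarrow> 0 < omega \<delta> \<sigma> r"
  by (simp add: omega_def add_nonneg_pos)

lemma omega_square: "0 < \<delta> \<Longrightarrow> (omega \<delta> \<sigma> r)\<^sup>2 = (r\<^sup>2 + \<sigma>\<^sup>2) / \<delta>"
  by (simp add: omega_def)

lemma omega_mono: "0 < \<delta> \<Longrightarrow> 0 \<le> r \<Longrightarrow> r \<le> s \<Longrightarrow> omega \<delta> \<sigma> r \<le> omega \<delta> \<sigma> s"
  by (simp add: omega_def divide_right_mono power_mono)

lemma strict_mono_signal_fraction: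
  fixes \<sigma> :: real
  assumes "0 < \<sigma>" "0 \<le> r" "r < s"
  shows "r\<^sup>2 / (r\<^sup>2 + \<sigma>\<^sup>2) < s\<^sup>2 / (s\<^sup>2 + \<sigma>\<^sup>2)"
proof -
  have "r\<^sup>2 < s\<^sup>2" using assms by (intro power_strict_mono) auto
  then have "r\<^sup>2 * \<sigma>\<^sup>2 < s\<^sup>2 * \<sigma>\<^sup>2" using assms by simp
  moreover have "0 < r\<^sup>2 + \<sigma>\<^sup>2" "0 < s\<^sup>2 + \<sigma>\<^sup>2" using assms by (auto intro: add_nonneg_pos)
  ultimately show ?thesis by (simp add: divide_simps algebra_simps)
qed

text \<open>Carries bounds on \<open>d = m r\<^sup>2 / (r\<^sup>2 + \<sigma>\<^sup>2)\<close> over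
  to \<open>r\<^sup>2 / \<sigma>\<^sup>2\<close>, which equals \<open>d / (m - d)\<close>.\<close>

lemma divide_complement_mono:
  fixes a b c :: real
  assumes "0 \<le> c" "a \<le> b" "b < c"
  shows "a / (c - a) \<le> b / (c - b)"
proof -
  have "c * a \<le> c * b" using assms by (intro mult_left_mono) auto
  moreover have "0 < c - a" "0 < c - b" using assms by auto
  ultimately show ?thesis
    by (simp only: pos_divide_le_eq pos_le_divide_eq times_divide_eq_left) (simp add: algebra_simps)
qed

locale fixed_point_setting = pointed_convex K \<mu> for K :: "(real ^ 'n) set" and \<mu> +
  fixes m :: nat and \<sigma> :: real
  assumes m: "1 \<le> m" and \<sigma>: "0 < \<sigma>"
begin

definition scale :: "real \<Rightarrow> real" where
  "scale = omega (real m / real CARD('n)) \<sigma>"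

definition ratio :: "real \<Rightarrow> real" where
  "ratio r = expected_err K \<mu> (scale r) / (scale r)\<^sup>2"

lemma delta_pos: "0 < real m / real CARD('n)"
  using m by simp

lemma scale_pos: "0 < scale r"
  unfolding scale_def by (intro omega_pos delta_pos \<sigma>)

lemma scale_square: "(scale r)\<^sup>2 = (r\<^sup>2 + \<sigma>\<^sup>2) * real CARD('n) / real m"
  unfolding scale_def omega_square[OF delta_pos] by simp

lemma noise_pos: "0 < r\<^sup>2 + \<sigma>\<^sup>2"
  using \<sigma> by (simp add: add_nonneg_pos)

lemma ratio_antimono: "0 \<le> r \<Longrightarrow> r \<le> s \<Longrightarrow> ratio s \<le> ratio r"
  unfolding ratio_def
  by (intro expected_err_ratio_antimono scale_pos) (simp add: scale_def omega_mono[OF delta_pos])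

lemma fp_map_eq_expected_err: "fp_map K \<mu> m \<sigma> r = expected_err K \<mu> (scale r) / real CARD('n)"
  by (simp add: fp_map_def expected_err_def scale_def)

text \<open>Writes the map as a decreasing factor times an affine function of
  \<open>r\<^sup>2\<close>. Both the reformulated equation and the chord bound for the iteration
  rest on this.\<close>

lemma fp_map_eq_ratio: "fp_map K \<mu> m \<sigma> r = ratio r * (r\<^sup>2 + \<sigma>\<^sup>2) / real m"
proof -
  \<comment> \<open>To be read with \<open>e\<close> the expected error,
    \<open>S = r\<^sup>2 + \<sigma>\<^sup>2\<close>, \<open>n\<close> the dimension and
    \<open>M = m\<close>.\<close>
  have eq: "e / n = e / (S * n / M) * S / M" if "0 < S" "0 < n" "0 < M" for e n S M :: real
    using that by simp
  show ?thesis
    unfolding fp_map_eq_expected_err ratio_def scale_square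
    by (rule eq) (use m noise_pos in auto)
qed

lemma fp_map_mono: "0 \<le> r \<Longrightarrow> r \<le> s \<Longrightarrow> fp_map K \<mu> m \<sigma> r \<le> fp_map K \<mu> m \<sigma> s"
  unfolding fp_map_eq_expected_err
  by (intro divide_right_mono expected_err_mono scale_pos) (simp_all add: scale_def omega_mono[OF delta_pos])

lemma is_fp_solution_iff:
  "is_fp_solution K \<mu> m \<sigma> r \<longleftrightarrow> 0 < r \<and> ratio r = real m * (r\<^sup>2 / (r\<^sup>2 + \<sigma>\<^sup>2))"
  unfolding is_fp_solution_def fp_map_eq_ratio
  using m noise_pos[of r] by (auto simp: field_simps)

lemma fp_solution_unique:
  assumes "is_fp_solution K \<mu> m \<sigma> r" "is_fp_solution K \<mu> m \<sigma> s"
  shows "r = s"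
proof -
  have "\<not> r < s" if "is_fp_solution K \<mu> m \<sigma> r" "is_fp_solution K \<mu> m \<sigma> s" for r s
  proof
    assume "r < s"
    with that have "real m * (s\<^sup>2 / (s\<^sup>2 + \<sigma>\<^sup>2)) \<le> real m * (r\<^sup>2 / (r\<^sup>2 + \<sigma>\<^sup>2))"
      using ratio_antimono[of r s] by (simp add: is_fp_solution_iff)
    moreover have "real m * (r\<^sup>2 / (r\<^sup>2 + \<sigma>\<^sup>2)) < real m * (s\<^sup>2 / (s\<^sup>2 + \<sigma>\<^sup>2))"
      using strict_mono_signal_fraction[OF \<sigma>, of r s] \<open>r < s\<close> that m
      by (intro mult_strict_left_mono) (auto simp: is_fp_solution_iff)
    ultimately show False by simp
  qed
  from this[OF assms] this[OF assms(2,1)] show ?thesis by simp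
qed

lemma stat_dim_le_fp_solution:
  assumes "is_fp_solution K \<mu> m \<sigma> r"
  shows "stat_dim K \<le> real m * (r\<^sup>2 / (r\<^sup>2 + \<sigma>\<^sup>2))"
  using stat_dim_le_ratio[OF scale_pos, of r] assms by (simp add: is_fp_solution_iff ratio_def)

lemma fp_solution_le_stat_dim_tangent_cone:
  assumes "is_fp_solution K \<mu> m \<sigma> r"
  shows "real m * (r\<^sup>2 / (r\<^sup>2 + \<sigma>\<^sup>2)) \<le> stat_dim (tangent_cone K \<mu>)"
  using ratio_le_stat_dim_tangent_cone[OF scale_pos, of r] assms
  by (simp add: is_fp_solution_iff ratio_def)

lemma stat_dim_less_if_fp_solution:
  assumes "is_fp_solution K \<mu> m \<sigma> r"
  shows "stat_dim K < real m"
proof -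
  note stat_dim_le_fp_solution[OF assms]
  also have "real m * (r\<^sup>2 / (r\<^sup>2 + \<sigma>\<^sup>2)) < real m * 1"
    using m \<sigma> noise_pos[of r] by (intro mult_strict_left_mono) auto
  finally show ?thesis by simp
qed

section \<open>Existence of a fixed point\<close>

lemma scale_at_top: "filterlim scale at_top at_top"
proof -
  define c where "c = real m / real CARD('n)"
  have "0 < c" using delta_pos by (simp add: c_def)
  then have "filterlim (\<lambda>r. sqrt ((r\<^sup>2 + \<sigma>\<^sup>2) / c)) at_top at_top"
    by real_asymp
  then show ?thesis by (simp add: scale_def omega_def [abs_def] c_def)
qed

lemma continuous_on_ratio: "continuous_on A ratio"
proof (rule continuous_at_imp_continuous_on, rule ballI)
  fix r
  have scale: "isCont scale r"
    unfolding scale_def omega_def [abs_def] using m by (intro continuous_intros) auto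
  have "isCont (\<lambda>r. expected_err K \<mu> (scale r)) r"
    by (rule isCont_o2[OF scale isCont_expected_err[OF scale_pos]])
  then show "isCont ratio r"
    unfolding ratio_def [abs_def] using scale scale_pos[of r]
    by (intro isCont_divide isCont_power) auto
qed

text \<open>Intermediate value theorem for the difference \<open>f\<close> of the two sides: at 0 it
  is the positive error ratio, since \<open>K\<close> has a second point and positive noise keeps
  \<open>scale 0\<close> positive; at infinity it tends to \<open>stat_dim K - m\<close>, which is
  negative.\<close>

lemma fp_solution_exists:
  assumes "K \<noteq> {\<mu>}" "stat_dim K < real m"
  shows "\<exists>r. is_fp_solution K \<mu> m \<sigma> r"
proof -
  define f where "f r = ratio r - real m * (r\<^sup>2 / (r\<^sup>2 + \<sigma>\<^sup>2))" for r
  have "((\<lambda>r. r\<^sup>2 / (r\<^sup>2 + \<sigma>\<^sup>2)) \<longlongrightarrow> 1) at_top"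
    using \<sigma> by real_asymp
  moreover have "(ratio \<longlongrightarrow> stat_dim K) at_top"
    unfolding ratio_def [abs_def]
    by (rule filterlim_compose[OF expected_err_ratio_tendsto_stat_dim scale_at_top])
  ultimately have "(f \<longlongrightarrow> stat_dim K - real m * 1) at_top"
    unfolding f_def [abs_def] by (intro tendsto_intros)
  then have "\<forall>\<^sub>F r in at_top. f r < 0"
    using assms by (intro order_tendstoD(2)) auto
  then obtain N where "\<And>r. N \<le> r \<Longrightarrow> f r < 0"
    unfolding eventually_at_top_linorder by blast
  then obtain b where b: "f b < 0" "0 < b"
    using max.cobounded1[of N 1] by (rule_tac that[of "max N 1"]) auto
  have f0: "0 < f 0"
    using expected_err_pos[OF assms(1) scale_pos, of 0] scale_pos[of 0] by (simp add: f_def ratio_def)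
  have "continuous_on {0..b} f"
    unfolding f_def [abs_def]
    by (intro continuous_intros continuous_on_ratio ballI less_imp_neq[OF noise_pos, symmetric])
  then obtain r where r: "0 \<le> r" "r \<le> b" "f r = 0"
    using IVT2'[of f b 0 0] b f0 by auto
  \<comment> \<open>The zero is not at \<open>r = 0\<close>, because \<open>f 0\<close> is
    positive.\<close>
  then have "is_fp_solution K \<mu> m \<sigma> r"
    using f0 by (cases "r = 0") (auto simp: is_fp_solution_iff f_def)
  then show ?thesis ..
qed

section \<open>Convergence of the iteration\<close>

text \<open>Since \<^const>\<open>ratio\<close> decreases, the map \<open>y \<mapsto> fp_map (sqrt y)\<close> lies above the chord from
  \<open>(-\<sigma>\<^sup>2, 0)\<close> to its fixed point, whose slope is the contraction rate. The contraction passes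
  from the squares to the iterates because these increase.\<close>

lemma fp_iteration_contracts:
  assumes sol: "is_fp_solution K \<mu> m \<sigma> r"
    and nonneg: "\<And>t. 0 \<le> x t" and x0: "(x 0)\<^sup>2 = 0"
    and step: "\<And>t. (x (Suc t))\<^sup>2 = fp_map K \<mu> m \<sigma> (x t)"
  shows "x t \<le> r" and "r - x (Suc t) \<le> r\<^sup>2 / (r\<^sup>2 + \<sigma>\<^sup>2) * (r - x t)"
proof -
  define \<kappa> where "\<kappa> = r\<^sup>2 / (r\<^sup>2 + \<sigma>\<^sup>2)"
  have r: "0 < r" "fp_map K \<mu> m \<sigma> r = r\<^sup>2"
    using sol by (auto simp: is_fp_solution_def)
  have rat: "ratio r = real m * \<kappa>"
    using sol unfolding is_fp_solution_iff \<kappa>_def by blast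
  have \<kappa>: "0 < \<kappa>" "\<kappa> < 1" using r \<sigma> noise_pos[of r] by (auto simp: \<kappa>_def)
  show le: "x t \<le> r" for t
  proof (induction t)
    case 0
    then show ?case using x0 r(1) by simp
  next
    case (Suc t)
    note step
    also have "fp_map K \<mu> m \<sigma> (x t) \<le> fp_map K \<mu> m \<sigma> r"
      by (rule fp_map_mono[OF nonneg Suc])
    also note r(2)
    finally show ?case
      by (rule power2_le_imp_le) (use r(1) in simp)
  qed
  \<comment> \<open>As \<open>x t \<le> r\<close>, the ratio at \<open>x t\<close> is at least its
    value \<open>m * \<kappa>\<close> at the fixed point.\<close>
  have "\<kappa> * ((x t)\<^sup>2 + \<sigma>\<^sup>2) \<le> ratio (x t) / real m * ((x t)\<^sup>2 + \<sigma>\<^sup>2)"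
  proof (rule mult_right_mono)
    show "\<kappa> \<le> ratio (x t) / real m"
      using ratio_antimono[OF nonneg le, of t] m rat by (simp add: pos_le_divide_eq mult.commute)
  qed (use noise_pos[of "x t"] in simp)
  then have chord: "\<kappa> * ((x t)\<^sup>2 + \<sigma>\<^sup>2) \<le> (x (Suc t))\<^sup>2"
    by (simp add: step fp_map_eq_ratio)
  have r_eq: "\<kappa> * (r\<^sup>2 + \<sigma>\<^sup>2) = r\<^sup>2" using noise_pos[of r] by (simp add: \<kappa>_def)
  have sq: "r\<^sup>2 - (x (Suc t))\<^sup>2 \<le> \<kappa> * (r\<^sup>2 - (x t)\<^sup>2)"
    using chord r_eq unfolding distrib_left right_diff_distrib by linarith
  also have "\<dots> \<le> 1 * (r\<^sup>2 - (x t)\<^sup>2)"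
    using \<kappa> power_mono[OF le nonneg, of t 2] by (intro mult_right_mono) auto
  finally have "(x t)\<^sup>2 \<le> (x (Suc t))\<^sup>2" by simp
  then have incr: "x t \<le> x (Suc t)"
    by (rule power2_le_imp_le[OF _ nonneg])
  \<comment> \<open>Factor the differences of squares, enlarge \<open>r + x t\<close> to
    \<open>r + x (Suc t)\<close>, and cancel this common factor.\<close>
  have "(r + x (Suc t)) * (r - x (Suc t)) \<le> \<kappa> * ((r + x t) * (r - x t))"
    using sq by (simp add: power2_eq_square algebra_simps)
  also have "\<dots> \<le> \<kappa> * ((r + x (Suc t)) * (r - x t))"
    using \<kappa> le[of t] incr by (intro mult_left_mono mult_right_mono) auto
  finally have "(r + x (Suc t)) * (r - x (Suc t)) \<le> (r + x (Suc t)) * (\<kappa> * (r - x t))"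
    by (simp add: algebra_simps)
  moreover have "0 < r + x (Suc t)" using r nonneg[of "Suc t"] by simp
  ultimately show "r - x (Suc t) \<le> r\<^sup>2 / (r\<^sup>2 + \<sigma>\<^sup>2) * (r - x t)"
    unfolding \<kappa>_def [symmetric] by (rule mult_left_le_imp_le)
qed

text \<open>The contraction by \<kappa> holds from the first step and the initial relative error is
  1, so the relative error after \<open>t\<close> steps is at most
  \<open>\<kappa> ^ t\<close>.\<close>

lemma fp_iteration_converges:
  assumes sol: "is_fp_solution K \<mu> m \<sigma> r"
    and nonneg: "\<forall>t. 0 \<le> x t" and x0: "(x 0)\<^sup>2 = 0"
    and step: "\<forall>t. (x (Suc t))\<^sup>2 = fp_map K \<mu> m \<sigma> (x t)"
  shows "r\<^sup>2 / (r\<^sup>2 + \<sigma>\<^sup>2) < \<rho> \<Longrightarrow> \<bar>x t - r\<bar> / r \<le> \<rho> ^ t"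
    and "x \<longlonglongrightarrow> r"
    and "\<exists>c. 0 < c \<and> c < 1 \<and> (\<forall>\<^sub>F t in sequentially. \<bar>x (Suc t) - r\<bar> \<le> c * \<bar>x t - r\<bar>)"
proof -
  define \<kappa> where "\<kappa> = r\<^sup>2 / (r\<^sup>2 + \<sigma>\<^sup>2)"
  have r: "0 < r" using sol by (simp add: is_fp_solution_def)
  have \<kappa>: "0 < \<kappa>" "\<kappa> < 1" using r \<sigma> noise_pos[of r] by (auto simp: \<kappa>_def)
  note con = fp_iteration_contracts[OF sol, of x, OF spec[OF nonneg] x0 spec[OF step], folded \<kappa>_def]
  have lin: "\<bar>x (Suc t) - r\<bar> \<le> \<kappa> * \<bar>x t - r\<bar>" for t
  proof -
    have "\<bar>x t - r\<bar> = r - x t" "\<bar>x (Suc t) - r\<bar> = r - x (Suc t)"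
      using con(1)[of t] con(1)[of "Suc t"] by auto
    then show ?thesis using con(2)[of t] by simp
  qed
  have geo: "\<bar>x t - r\<bar> \<le> \<kappa> ^ t * r" for t
  proof (induction t)
    case 0
    then show ?case using x0 r by simp
  next
    case (Suc t)
    have "\<bar>x (Suc t) - r\<bar> \<le> \<kappa> * \<bar>x t - r\<bar>" by (rule lin)
    also have "\<dots> \<le> \<kappa> * (\<kappa> ^ t * r)" using \<kappa> Suc by (intro mult_left_mono) auto
    finally show ?case by simp
  qed
  show "\<bar>x t - r\<bar> / r \<le> \<rho> ^ t" if "r\<^sup>2 / (r\<^sup>2 + \<sigma>\<^sup>2) < \<rho>" for t
  proof -
    have "\<bar>x t - r\<bar> / r \<le> \<kappa> ^ t" using geo[of t] r by (simp add: pos_divide_le_eq)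
    also have "\<dots> \<le> \<rho> ^ t" using that [folded \<kappa>_def] \<kappa> by (intro power_mono) auto
    finally show ?thesis .
  qed
  have "(\<lambda>t. \<kappa> ^ t * r) \<longlonglongrightarrow> 0 * r"
    using \<kappa> by (intro tendsto_mult tendsto_const LIMSEQ_power_zero) auto
  then have "(\<lambda>t. \<kappa> ^ t * r) \<longlonglongrightarrow> 0" by simp
  then have "(\<lambda>t. x t - r) \<longlonglongrightarrow> 0"
    by (rule Lim_null_comparison[rotated]) (simp add: geo)
  then show "x \<longlonglongrightarrow> r" by (rule LIM_zero_cancel)
  show "\<exists>c. 0 < c \<and> c < 1 \<and> (\<forall>\<^sub>F t in sequentially. \<bar>x (Suc t) - r\<bar> \<le> c * \<bar>x t - r\<bar>)"
    using \<kappa> lin by (intro exI[of _ \<kappa>] conjI always_eventually allI)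
qed

section \<open>Bounds on the signal-to-noise ratio\<close>

lemma signal_to_noise_eq:
  assumes d: "d = real m * (r\<^sup>2 / (r\<^sup>2 + \<sigma>\<^sup>2))"
  shows "r\<^sup>2 / \<sigma>\<^sup>2 = d / (real m - d)" "d < real m"
proof -
  have "\<sigma>\<^sup>2 / (r\<^sup>2 + \<sigma>\<^sup>2) = 1 - r\<^sup>2 / (r\<^sup>2 + \<sigma>\<^sup>2)"
    using \<sigma> noise_pos[of r] by (simp add: divide_simps)
  then have compl: "real m - d = real m * (\<sigma>\<^sup>2 / (r\<^sup>2 + \<sigma>\<^sup>2))"
    by (simp add: d right_diff_distrib)
  have "r\<^sup>2 / \<sigma>\<^sup>2 = real m * (r\<^sup>2 / (r\<^sup>2 + \<sigma>\<^sup>2)) / (real m * (\<sigma>\<^sup>2 / (r\<^sup>2 + \<sigma>\<^sup>2)))"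
    using m \<sigma> noise_pos[of r] by simp
  then show "r\<^sup>2 / \<sigma>\<^sup>2 = d / (real m - d)"
    unfolding compl unfolding d .
  have "0 < real m * (\<sigma>\<^sup>2 / (r\<^sup>2 + \<sigma>\<^sup>2))"
    using m \<sigma> noise_pos[of r] by simp
  then show "d < real m" using compl by simp
qed

lemma fp_solution_lower_bound:
  assumes "is_fp_solution K \<mu> m \<sigma> r"
  shows "stat_dim K / (real m - stat_dim K) \<le> r\<^sup>2 / \<sigma>\<^sup>2"
proof -
  define d where "d = real m * (r\<^sup>2 / (r\<^sup>2 + \<sigma>\<^sup>2))"
  have "stat_dim K \<le> d" using stat_dim_le_fp_solution[OF assms] by (simp add: d_def)
  with signal_to_noise_eq[OF d_def] show ?thesis
    by (simp add: divide_complement_mono)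
qed

lemma fp_solution_upper_bound:
  assumes "is_fp_solution K \<mu> m \<sigma> r"
  defines "D \<equiv> stat_dim (tangent_cone K \<mu>)"
  shows "D < real m \<Longrightarrow> r\<^sup>2 / \<sigma>\<^sup>2 \<le> D / (real m - D)"
    and "ereal (r\<^sup>2 / \<sigma>\<^sup>2) \<le> ereal D / ereal (max (real m - D) 0)"
proof -
  define d where "d = real m * (r\<^sup>2 / (r\<^sup>2 + \<sigma>\<^sup>2))"
  have "d \<le> D" using fp_solution_le_stat_dim_tangent_cone[OF assms(1)] by (simp add: d_def D_def)
  with signal_to_noise_eq[OF d_def]
  show le: "r\<^sup>2 / \<sigma>\<^sup>2 \<le> D / (real m - D)" if "D < real m"
    using that by (simp add: divide_complement_mono)
  show "ereal (r\<^sup>2 / \<sigma>\<^sup>2) \<le> ereal D / ereal (max (real m - D) 0)"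
  proof (cases "D < real m")
    case True
    then show ?thesis using le by simp
  next
    case False
    \<comment> \<open>Positivity of the numerator matters: the extended real quotient of a positive
      number by 0 is infinite, so the bound holds.\<close>
    then have "0 < D" using m by simp
    with False show ?thesis by (simp add: max_absorb2)
  qed
qed

end

text \<open>The upper bound makes \<open>r s\<close> at most proportional to \<open>s\<close>, so
  the projection scale \<open>\<tau> s\<close> tends to 0. The error ratio there tends to the
  dimension of the tangent cone, and the signal-to-noise ratio depends continuously on it.\<close>

lemma (in pointed_convex) fp_solution_low_noise:
  assumes m: "1 \<le> m" and D: "stat_dim (tangent_cone K \<mu>) < real m"
    and sol: "\<forall>s>0. is_fp_solution K \<mu> m s (r s)"
  shows "((\<lambda>s. (r s)\<^sup>2 / s\<^sup>2) \<longlongrightarrow>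
      stat_dim (tangent_cone K \<mu>) / (real m - stat_dim (tangent_cone K \<mu>))) (at_right 0)"
proof -
  define D where "D = stat_dim (tangent_cone K \<mu>)"
  define B where "B = D / (real m - D)"
  define c where "c = real CARD('n) / real m"
  define \<tau> where "\<tau> s = omega (real m / real CARD('n)) s (r s)" for s
  define d where "d s = expected_err K \<mu> (\<tau> s) / (\<tau> s)\<^sup>2" for s
  \<comment> \<open>The noise level varies here, so the locale is instantiated separately at each
    \<open>s\<close>.\<close>
  have setting: "fixed_point_setting K \<mu> m s" if "0 < s" for s
    using m that by unfold_locales
  have pos: "\<forall>\<^sub>F s :: real in at_right 0. 0 < s" by (rule eventually_at_right_less)
  have \<tau>_pos: "0 < \<tau> s" if "0 < s" for s
    using m that by (simp add: \<tau>_def omega_pos)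
  have c: "0 < c" using m by (simp add: c_def)
  \<comment> \<open>From \<open>(r s)\<^sup>2 \<le> B * s\<^sup>2\<close> one gets
    \<open>(r s)\<^sup>2 + s\<^sup>2 \<le> (B + 1) * s\<^sup>2\<close>; the factor \<open>c\<close>
    is the inverse of the \<open>m / n\<close> in \<open>omega\<close>.\<close>
  have \<tau>_le: "\<tau> s \<le> s * sqrt ((B + 1) * c)" if s: "0 < s" for s
  proof -
    interpret fixed_point_setting K \<mu> m s by (rule setting[OF s])
    have "(r s)\<^sup>2 / s\<^sup>2 \<le> B"
      using fp_solution_upper_bound(1)[of "r s"] sol s D by (simp add: B_def D_def)
    then have "(r s)\<^sup>2 + s\<^sup>2 \<le> s\<^sup>2 * (B + 1)" using s by (simp add: field_simps)
    then have "((r s)\<^sup>2 + s\<^sup>2) * c \<le> s\<^sup>2 * (B + 1) * c" using c by (intro mult_right_mono) auto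
    then have "sqrt (((r s)\<^sup>2 + s\<^sup>2) * c) \<le> sqrt (s\<^sup>2 * ((B + 1) * c))" by (simp add: mult.assoc)
    also have "\<dots> = s * sqrt ((B + 1) * c)" using s by (simp add: real_sqrt_mult)
    finally show ?thesis by (simp add: \<tau>_def omega_def c_def)
  qed
  have "((\<lambda>s. s * sqrt ((B + 1) * c)) \<longlongrightarrow> 0 * sqrt ((B + 1) * c)) (at_right 0)"
    by (intro tendsto_intros)
  then have "(\<tau> \<longlongrightarrow> 0) (at_right 0)"
    using pos by (intro tendsto_sandwich[of "\<lambda>_. 0" \<tau> _ "\<lambda>s. s * sqrt ((B + 1) * c)"])
      (auto elim!: eventually_mono intro: \<tau>_le less_imp_le[OF \<tau>_pos])
  then have "filterlim \<tau> (at_right 0) (at_right 0)"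
    using pos by (intro filterlim_at_withinI) (auto elim!: eventually_mono dest: \<tau>_pos)
  then have "(d \<longlongrightarrow> D) (at_right 0)"
    unfolding d_def [abs_def] D_def by (rule filterlim_compose[OF expected_err_ratio_tendsto_tangent])
  then have "((\<lambda>s. d s / (real m - d s)) \<longlongrightarrow> D / (real m - D)) (at_right 0)"
    using D by (intro tendsto_intros) (auto simp: D_def)
  moreover have "\<forall>\<^sub>F s in at_right 0. d s / (real m - d s) = (r s)\<^sup>2 / s\<^sup>2"
    using pos
  proof (rule eventually_mono)
    fix s :: real assume s: "0 < s"
    interpret fixed_point_setting K \<mu> m s by (rule setting[OF s])
    have "ratio (r s) = real m * ((r s)\<^sup>2 / ((r s)\<^sup>2 + s\<^sup>2))"
      using is_fp_solution_iff[of "r s"] sol s by blast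
    then show "d s / (real m - d s) = (r s)\<^sup>2 / s\<^sup>2"
      using signal_to_noise_eq(1)[of "d s" "r s"]
      by (simp add: d_def ratio_def scale_def \<tau>_def)
  qed
  ultimately show ?thesis
    unfolding D_def by (rule Lim_transform_eventually)
qed

text \<open>For a one-point \<open>K\<close> the error vanishes identically and the equation has no
  positive root, hence the side condition on existence. The upper bound is an extended real because
  its denominator may be 0, and truncated subtraction \<open>t - T\<close> expresses the positive
  part.\<close>

theorem proposition2p1:
  fixes K :: "(real ^ 'n) set" and \<mu>\<^sub>0 :: "real ^ 'n" and m :: nat and \<sigma> :: real
  assumes "1 \<le> m" and "0 < \<sigma>" and "closed K" and "convex K" and "\<mu>\<^sub>0 \<in> K"
  shows
    "((\<forall>r r'. is_fp_solution K \<mu>\<^sub>0 m \<sigma> r \<longrightarrow> is_fp_solution K \<mu>\<^sub>0 m \<sigma> r' \<longrightarrow> r = r') \<and>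
      (K \<noteq> {\<mu>\<^sub>0} \<longrightarrow> ((\<exists>r. is_fp_solution K \<mu>\<^sub>0 m \<sigma> r) \<longleftrightarrow> stat_dim K < real m)))
    \<and>
     (stat_dim K < real m \<longrightarrow>
       (\<forall>r\<^sub>n x. is_fp_solution K \<mu>\<^sub>0 m \<sigma> r\<^sub>n \<longrightarrow>
          (\<forall>t::nat. 0 \<le> x t) \<longrightarrow> (x 0)\<^sup>2 = 0 \<longrightarrow> (\<forall>t. (x (Suc t))\<^sup>2 = fp_map K \<mu>\<^sub>0 m \<sigma> (x t)) \<longrightarrow>
          (\<forall>\<rho>. r\<^sub>n\<^sup>2 / (r\<^sub>n\<^sup>2 + \<sigma>\<^sup>2) < \<rho> \<and> \<rho> < 1 \<longrightarrow>
             (\<exists>T::nat. \<forall>t. \<bar>x t - r\<^sub>n\<bar> / r\<^sub>n \<le> \<rho> ^ (t - T))) \<and>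
          x \<longlonglongrightarrow> r\<^sub>n \<and>
          (\<exists>c. 0 < c \<and> c < 1 \<and>
             (\<forall>\<^sub>F t in sequentially. \<bar>x (Suc t) - r\<^sub>n\<bar> \<le> c * \<bar>x t - r\<^sub>n\<bar>))))
    \<and>
     (stat_dim K < real m \<longrightarrow>
       (\<forall>r\<^sub>n. is_fp_solution K \<mu>\<^sub>0 m \<sigma> r\<^sub>n \<longrightarrow>
          stat_dim K / (real m - stat_dim K) \<le> r\<^sub>n\<^sup>2 / \<sigma>\<^sup>2 \<and>
          ereal (r\<^sub>n\<^sup>2 / \<sigma>\<^sup>2) \<le>
            ereal (stat_dim (tangent_cone K \<mu>\<^sub>0)) /
            ereal (max (real m - stat_dim (tangent_cone K \<mu>\<^sub>0)) 0)))
    \<and>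
     (stat_dim K < real m \<longrightarrow> stat_dim (tangent_cone K \<mu>\<^sub>0) < real m \<longrightarrow>
       (\<forall>r\<^sub>n :: real \<Rightarrow> real. (\<forall>s>0. is_fp_solution K \<mu>\<^sub>0 m s (r\<^sub>n s)) \<longrightarrow>
          ((\<lambda>s. (r\<^sub>n s)\<^sup>2 / s\<^sup>2) \<longlongrightarrow>
             stat_dim (tangent_cone K \<mu>\<^sub>0) / (real m - stat_dim (tangent_cone K \<mu>\<^sub>0))) (at_right 0)))"
proof -
  interpret fixed_point_setting K \<mu>\<^sub>0 m \<sigma>
    using assms by unfold_locales
  show ?thesis
  proof (intro conjI allI impI)
    show "r = r'" if "is_fp_solution K \<mu>\<^sub>0 m \<sigma> r" "is_fp_solution K \<mu>\<^sub>0 m \<sigma> r'" for r r'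
      using that by (rule fp_solution_unique)
    show "(\<exists>r. is_fp_solution K \<mu>\<^sub>0 m \<sigma> r) \<longleftrightarrow> stat_dim K < real m" if "K \<noteq> {\<mu>\<^sub>0}"
      using fp_solution_exists[OF that] stat_dim_less_if_fp_solution by blast
  next
    fix r\<^sub>n \<rho> and x :: "nat \<Rightarrow> real"
    assume sol: "is_fp_solution K \<mu>\<^sub>0 m \<sigma> r\<^sub>n"
      and x: "\<forall>t. 0 \<le> x t" "(x 0)\<^sup>2 = 0" "\<forall>t. (x (Suc t))\<^sup>2 = fp_map K \<mu>\<^sub>0 m \<sigma> (x t)"
    note conv = fp_iteration_converges[OF sol x]
    show "\<exists>T. \<forall>t. \<bar>x t - r\<^sub>n\<bar> / r\<^sub>n \<le> \<rho> ^ (t - T)"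
      if "r\<^sub>n\<^sup>2 / (r\<^sub>n\<^sup>2 + \<sigma>\<^sup>2) < \<rho> \<and> \<rho> < 1"
    proof -
      \<comment> \<open>The contraction starts at once, so the waiting time 0 serves every
        \<rho>.\<close>
      have "\<forall>t. \<bar>x t - r\<^sub>n\<bar> / r\<^sub>n \<le> \<rho> ^ (t - 0)"
        using conv(1)[of \<rho>] that by simp
      then show ?thesis ..
    qed
    show "x \<longlonglongrightarrow> r\<^sub>n" by (rule conv(2))
    show "\<exists>c. 0 < c \<and> c < 1 \<and> (\<forall>\<^sub>F t in sequentially. \<bar>x (Suc t) - r\<^sub>n\<bar> \<le> c * \<bar>x t - r\<^sub>n\<bar>)"
      by (rule conv(3))
  next
    fix r\<^sub>n
    assume sol: "is_fp_solution K \<mu>\<^sub>0 m \<sigma> r\<^sub>n"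
    show "stat_dim K / (real m - stat_dim K) \<le> r\<^sub>n\<^sup>2 / \<sigma>\<^sup>2"
      by (rule fp_solution_lower_bound[OF sol])
    show "ereal (r\<^sub>n\<^sup>2 / \<sigma>\<^sup>2) \<le> ereal (stat_dim (tangent_cone K \<mu>\<^sub>0)) /
        ereal (max (real m - stat_dim (tangent_cone K \<mu>\<^sub>0)) 0)"
      by (rule fp_solution_upper_bound(2)[OF sol])
  next
    fix r\<^sub>n :: "real \<Rightarrow> real"
    assume "stat_dim (tangent_cone K \<mu>\<^sub>0) < real m"
      and "\<forall>s>0. is_fp_solution K \<mu>\<^sub>0 m s (r\<^sub>n s)"
    then show "((\<lambda>s. (r\<^sub>n s)\<^sup>2 / s\<^sup>2) \<longlongrightarrow>
        stat_dim (tangent_cone K \<mu>\<^sub>0) / (real m - stat_dim (tangent_cone K \<mu>\<^sub>0))) (at_right 0)"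
      by (rule fp_solution_low_noise[OF assms(1)])
  qed
qed

end
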